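(* Let $q\in(0,1)$, let $I$ be a real interval containing $0$, and suppose $a,b\in I$, $a<b$, and $a,b\in[c]_q$ for some $c\in I$. Let $\alpha,\beta\in\mathbb R$ and let $L(t,u,v)$ be a real function on $I\times\mathbb R^2$. Consider the problem of extremizing $$\mathcal L[y]=\int_a^bL\left(t,y(qt),\tilde D_q[y](t)\right)\tilde d_qt$$ over all $y\in\mathcal Y^1([a,b]_q,\mathbb R)$ with $y(a)=\alpha$ and $y(b)=\beta$ (such $y$ are called admissible), where $L$ satisfies: (i) $(u,v)\mapsto L(t,u,v)$ is a $C^1(\mathbb R^2,\mathbb R)$ function for every $t\in[a,b]$; (ii) $t\mapsto L(t,y(qt),\tilde D_q[y](t))$ is continuous at $0$ for every admissible $y$; (iii) for every admissible $y$ and $i=0,1$, the function $t\mapsto\partial_{i+2}L(t,y(qt),\tilde D_q[y](t))$ belongs to $\mathcal Y^1([a,b]_q,\mathbb R)$. Assume that $L$ is jointly convex (resp. jointly concave) in $(u,v)$. If an admissible function $y_*$ satisfies (with $y=y_*$) the $q$-symmetric Euler–Lagrange equation $$\partial_2L\left(t,y(qt),\tilde D_q[y](t)\right)=\tilde D_q\left[\tau\mapsto\partial_3L\left(q\tau,y(q^2\tau),\tilde D_q[y](q\tau)\right)\right](t)\quad\text{for all }t\in[a,b]_q,$$ then $y_*$ is a global minimizer (resp. global maximizer) of the problem, i.e. $\mathcal L[y_*]\le\mathcal L[y]$ (resp. $\ge$) for all admissible $y$.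
   Context: $q$-symmetric derivative: for $f:I\to\mathbb R$ and $t\in qI\setminus\{0\}$, $\tilde D_q[f](t)=\frac{f(qt)-f(q^{-1}t)}{(q-q^{-1})t}$, and $\tilde D_q[f](0)=f'(0)$ provided $f$ is differentiable at $0$. $\partial_jL$ is the partial derivative of $L$ with respect to its $j$th argument. Integral: $\int_a^bf\,\tilde d_qt=\int_0^bf\,\tilde d_qt-\int_0^af\,\tilde d_qt$, where $\int_0^xf(t)\,\tilde d_qt=(1-q^2)x\sum_{n=0}^{\infty}q^{2n}f(q^{2n+1}x)$, provided the series converge. Sets: $[s]_q=\{q^{2n+1}s:n\in\mathbb N_0\}\cup\{0\}$ and $[a,b]_q=[a]_q\cup[b]_q$. Spaces: $\mathcal Y^1([a,b]_q,\mathbb R)$ is the set of $y:I\to\mathbb R$ such that $y$ and $\tilde D_q[y]$ are bounded on $[a,b]_q$ and continuous at $0$. $L$ is jointly convex (resp. jointly concave) in $(u,v)$ if $\partial_2L,\partial_3L$ exist and are continuous and $L(t,u+u_1,v+v_1)-L(t,u,v)\ge$ (resp. $\le$) $\partial_2L(t,u,v)u_1+\partial_3L(t,u,v)v_1$ for all $(t,u,v),(t,u+u_1,v+v_1)\in I\times\mathbb R^2$. *)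

theory Defs
  imports "HOL-Analysis.Analysis"
begin

(* Functions on the interval I (or on q I) are total functions real => real.  All notions
   below only use their values at points where the mathematical expression is defined:
   the points of qpts2 q a b, and a neighbourhood of 0 in I (which lies in q I, q^2 I, ...). *)

definition qpts :: "real \<Rightarrow> real \<Rightarrow> real set"
  where "qpts q s = {q ^ (2 * n + 1) * s | n. True} \<union> {0}"

definition qpts2 :: "real \<Rightarrow> real \<Rightarrow> real \<Rightarrow> real set"
  where "qpts2 q a b = qpts q a \<union> qpts q b"

(* The derivative at 0 is taken within I because 0 may be an endpoint of I.  It is an
   unspecified value when f is not differentiable there; qY1 demands differentiability. *)
definition qsymD :: "real \<Rightarrow> real set \<Rightarrow> (real \<Rightarrow> real) \<Rightarrow> real \<Rightarrow> real"
  where "qsymD q I f t =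
    (if t = 0 then vector_derivative f (at 0 within I)
     else (f (q * t) - f (inverse q * t)) / ((q - inverse q) * t))"

(* The series converges absolutely whenever f is continuous at 0 within I and x is in I,
   because then f is bounded along q^(2n+1) x; divergent series are not given a meaning. *)
definition qint0 :: "real \<Rightarrow> real \<Rightarrow> (real \<Rightarrow> real) \<Rightarrow> real"
  where "qint0 q x f = (1 - q\<^sup>2) * x * (\<Sum>n. q ^ (2 * n) * f (q ^ (2 * n + 1) * x))"

definition qint :: "real \<Rightarrow> real \<Rightarrow> real \<Rightarrow> (real \<Rightarrow> real) \<Rightarrow> real"
  where "qint q a b f = qint0 q b f - qint0 q a f"

definition qY1 :: "real \<Rightarrow> real set \<Rightarrow> real \<Rightarrow> real \<Rightarrow> (real \<Rightarrow> real) set"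
  where "qY1 q I a b = {y.
    bounded (y ` qpts2 q a b) \<and> continuous (at 0 within I) y \<and>
    y differentiable (at 0 within I) \<and>
    bounded (qsymD q I y ` qpts2 q a b) \<and> continuous (at 0 within I) (qsymD q I y)}"

definition partial2 :: "(real \<Rightarrow> real \<Rightarrow> real \<Rightarrow> real) \<Rightarrow> real \<Rightarrow> real \<Rightarrow> real \<Rightarrow> real"
  where "partial2 L t u v = deriv (\<lambda>x. L t x v) u"

definition partial3 :: "(real \<Rightarrow> real \<Rightarrow> real \<Rightarrow> real) \<Rightarrow> real \<Rightarrow> real \<Rightarrow> real \<Rightarrow> real"
  where "partial3 L t u v = deriv (\<lambda>x. L t u x) v"

definition C1_plane :: "(real \<times> real \<Rightarrow> real) \<Rightarrow> bool"
  where "C1_plane F \<longleftrightarrow> (\<exists>F' :: real \<times> real \<Rightarrow> (real \<times> real) \<Rightarrow>\<^sub>L real.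
    (\<forall>p. (F has_derivative blinfun_apply (F' p)) (at p)) \<and> continuous_on UNIV F')"

definition continuous_partials :: "real set \<Rightarrow> (real \<Rightarrow> real \<Rightarrow> real \<Rightarrow> real) \<Rightarrow> bool"
  where "continuous_partials I L \<longleftrightarrow>
    (\<forall>t\<in>I. \<forall>u v. (\<lambda>x. L t x v) field_differentiable (at u) \<and>
                 (\<lambda>x. L t u x) field_differentiable (at v)) \<and>
    continuous_on (I \<times> UNIV \<times> UNIV) (\<lambda>(t, u, v). partial2 L t u v) \<and>
    continuous_on (I \<times> UNIV \<times> UNIV) (\<lambda>(t, u, v). partial3 L t u v)"

definition jointly_convex :: "real set \<Rightarrow> (real \<Rightarrow> real \<Rightarrow> real \<Rightarrow> real) \<Rightarrow> bool"
  where "jointly_convex I L \<longleftrightarrow> continuous_partials I L \<and>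
    (\<forall>t\<in>I. \<forall>u v u1 v1. L t (u + u1) (v + v1) - L t u v
        \<ge> partial2 L t u v * u1 + partial3 L t u v * v1)"

definition jointly_concave :: "real set \<Rightarrow> (real \<Rightarrow> real \<Rightarrow> real \<Rightarrow> real) \<Rightarrow> bool"
  where "jointly_concave I L \<longleftrightarrow> continuous_partials I L \<and>
    (\<forall>t\<in>I. \<forall>u v u1 v1. L t (u + u1) (v + v1) - L t u v
        \<le> partial2 L t u v * u1 + partial3 L t u v * v1)"

definition admissible ::
    "real \<Rightarrow> real set \<Rightarrow> real \<Rightarrow> real \<Rightarrow> real \<Rightarrow> real \<Rightarrow> (real \<Rightarrow> real) \<Rightarrow> bool"
  where "admissible q I a b \<alpha> \<beta> y \<longleftrightarrow> y \<in> qY1 q I a b \<and> y a = \<alpha> \<and> y b = \<beta>"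

definition qfunctional ::
    "real \<Rightarrow> real set \<Rightarrow> real \<Rightarrow> real \<Rightarrow> (real \<Rightarrow> real \<Rightarrow> real \<Rightarrow> real) \<Rightarrow> (real \<Rightarrow> real) \<Rightarrow> real"
  where "qfunctional q I a b L y = qint q a b (\<lambda>t. L t (y (q * t)) (qsymD q I y t))"

definition global_minimizer ::
    "real \<Rightarrow> real set \<Rightarrow> real \<Rightarrow> real \<Rightarrow> real \<Rightarrow> real \<Rightarrow> (real \<Rightarrow> real \<Rightarrow> real \<Rightarrow> real)
      \<Rightarrow> (real \<Rightarrow> real) \<Rightarrow> bool"
  where "global_minimizer q I a b \<alpha> \<beta> L ys \<longleftrightarrow> admissible q I a b \<alpha> \<beta> ys \<and>
    (\<forall>y. admissible q I a b \<alpha> \<beta> y \<longrightarrow> qfunctional q I a b L ys \<le> qfunctional q I a b L y)"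

definition global_maximizer ::
    "real \<Rightarrow> real set \<Rightarrow> real \<Rightarrow> real \<Rightarrow> real \<Rightarrow> real \<Rightarrow> (real \<Rightarrow> real \<Rightarrow> real \<Rightarrow> real)
      \<Rightarrow> (real \<Rightarrow> real) \<Rightarrow> bool"
  where "global_maximizer q I a b \<alpha> \<beta> L ys \<longleftrightarrow> admissible q I a b \<alpha> \<beta> ys \<and>
    (\<forall>y. admissible q I a b \<alpha> \<beta> y \<longrightarrow> qfunctional q I a b L ys \<ge> qfunctional q I a b L y)"

end

theory Submission
  imports Defs
begin

text \<open>
  Put \<open>h = y - ystar\<close> and let \<open>g\<close> be \<open>\<partial>\<^sub>3L\<close> along \<open>ystar\<close>. In the convex case,
  joint convexity bounds the difference of the two integrands from below by \<open>\<partial>\<^sub>2L h(q t) + g(t) D[h](t)\<close>. By the Euler--Lagrange equation and the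
  product rule, this lower bound is the \<open>q\<close>-symmetric derivative of \<open>s \<mapsto> g(q s) h(s)\<close>,
  so its integral telescopes to \<open>g(q b) h(b) - g(q a) h(a) = 0\<close>,
  the limits at \<open>0\<close> cancelling by continuity. The integral is monotone
  because \<open>a\<close> and \<open>b\<close> lie on one lattice \<open>[c]\<^sub>q\<close>: then \<open>\<integral>\<^sub>a\<^sup>b\<close> only involves lattice points between
  \<open>a\<close> and \<open>b\<close>, with positive weights. For unrelated \<open>a\<close> and \<open>b\<close> this fails.
\<close>

section \<open>Integration between points of one lattice\<close>

definition qsummable :: "real \<Rightarrow> real \<Rightarrow> (real \<Rightarrow> real) \<Rightarrow> bool"
  where "qsummable q x f \<longleftrightarrow> summable (\<lambda>n. q ^ (2 * n) * f (q ^ (2 * n + 1) * x))"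

text \<open>Linearity needs convergence: \<open>suminf\<close> of a divergent series is an
  unspecified value, and \<open>qsummable\<close> excludes that case.\<close>

lemma qint0_diff:
  assumes "qsummable q x f" "qsummable q x g"
  shows "qint0 q x (\<lambda>t. f t - g t) = qint0 q x f - qint0 q x g"
  using suminf_diff[OF assms[unfolded qsummable_def], symmetric]
  by (simp add: qint0_def right_diff_distrib)

lemma qsummable_diff:
  assumes "qsummable q x f" "qsummable q x g"
  shows "qsummable q x (\<lambda>t. f t - g t)"
  using summable_diff[OF assms[unfolded qsummable_def]]
  by (simp add: qsummable_def right_diff_distrib)

lemma qint_diff:
  assumes "\<And>x. x \<in> {a, b} \<Longrightarrow> qsummable q x f" "\<And>x. x \<in> {a, b} \<Longrightarrow> qsummable q x g"
  shows "qint q a b (\<lambda>t. f t - g t) = qint q a b f - qint q a b g"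
  using assms by (simp add: qint_def qint0_diff)

text \<open>The nodes of \<open>q ^ (2 * k) * x\<close> are those of \<open>x\<close> with the first
  \<open>k\<close> dropped, and the prefactor supplies the missing weight
  \<open>q ^ (2 * k)\<close>. So the infinite tails cancel and a finite sum is left.\<close>

lemma qint0_lattice_step:
  assumes "qsummable q x f" "q \<noteq> 0"
  shows "qint0 q x f - qint0 q (q ^ (2 * k) * x) f
    = (1 - q\<^sup>2) * x * (\<Sum>n<k. q ^ (2 * n) * f (q ^ (2 * n + 1) * x))"
proof -
  let ?s = "\<lambda>n. q ^ (2 * n) * f (q ^ (2 * n + 1) * x)"
  have sum: "summable ?s" using assms(1) by (simp add: qsummable_def)
  let ?u = "\<lambda>n. q ^ (2 * n) * f (q ^ (2 * n + 1) * (q ^ (2 * k) * x))"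
  have shift: "(\<lambda>n. ?s (n + k)) = (\<lambda>n. q ^ (2 * k) * ?u n)"
    by (simp add: power_add algebra_simps)
  have "summable (\<lambda>n. q ^ (2 * k) * ?u n)"
    unfolding shift[symmetric] using sum by (rule summable_ignore_initial_segment)
  then have "summable ?u"
    by (rule summable_mult_D) (use assms(2) in simp)
  then have "q ^ (2 * k) * (\<Sum>n. ?u n) = (\<Sum>n. ?s (n + k))"
    unfolding shift by (rule suminf_mult[symmetric])
  also have "\<dots> = (\<Sum>n. ?s n) - (\<Sum>n<k. ?s n)"
    using sum by (rule suminf_minus_initial_segment)
  finally have split: "(\<Sum>n. ?s n) = (\<Sum>n<k. ?s n) + q ^ (2 * k) * (\<Sum>n. ?u n)"
    by linarith
  have arith: "d * x * (A + p * U) - d * (p * x) * U = d * x * A" for d A p U :: real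
    by (simp add: algebra_simps)
  show ?thesis
    unfolding qint0_def split by (rule arith)
qed

text \<open>All nonzero points of \<open>qpts q c\<close> lie on the same side of 0, so if
  \<open>a\<close> and \<open>b\<close> are both nonzero, the one nearer to 0 is an even power of
  \<open>q\<close> times the other. The integral is then a finite sum over nodes of the farther
  endpoint; if one endpoint is 0, it is a single full series.\<close>

lemma qint_lattice_nonneg:
  assumes q: "0 < q" "q < 1"
    and ab: "a < b" "a \<in> qpts q c" "b \<in> qpts q c"
    and sum: "\<And>x. x \<in> {a, b} \<Longrightarrow> qsummable q x f"
    and nonneg: "\<And>t. t \<in> qpts2 q a b \<Longrightarrow> 0 \<le> f t"
  shows "0 \<le> qint q a b f"
proof -
  have q2: "0 < 1 - q\<^sup>2" using q by (simp add: power_less_one_iff)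
  have pts: "0 \<le> q ^ (2 * n) * f (q ^ (2 * n + 1) * x)" if "x \<in> {a, b}" for x n
  proof -
    have "q ^ (2 * n + 1) * x \<in> qpts2 q a b"
      using that unfolding qpts2_def qpts_def by blast
    from nonneg[OF this] show ?thesis using q by simp
  qed
  have series: "0 \<le> (\<Sum>n. q ^ (2 * n) * f (q ^ (2 * n + 1) * x))"
    and partial: "0 \<le> (\<Sum>n<k. q ^ (2 * n) * f (q ^ (2 * n + 1) * x))"
    if "x \<in> {a, b}" for x k
    using sum[OF that] pts[OF that] by (auto simp: qsummable_def intro!: suminf_nonneg sum_nonneg)
  have qc: "q ^ (2 * (m + k) + 1) * c = q ^ (2 * k) * (q ^ (2 * m + 1) * c)" for m k
    by (simp add: power_add algebra_simps)
  have anti: "q ^ (2 * n + 1) \<le> q ^ (2 * m + 1)" if "m \<le> n" for m n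
    using q that by (intro power_decreasing) auto
  have cases: "a = 0 \<or> b = 0 \<or> (0 < b \<and> (\<exists>k. a = q ^ (2 * k) * b)) \<or> (a < 0 \<and> (\<exists>k. b = q ^ (2 * k) * a))"
  proof (cases "a = 0 \<or> b = 0")
    case False
    then obtain m n where a: "a = q ^ (2 * n + 1) * c" and b: "b = q ^ (2 * m + 1) * c"
      using ab by (auto simp: qpts_def)
    show ?thesis
    proof (cases "0 < c")
      case True
      have "m \<le> n"
      proof (rule ccontr)
        assume "\<not> m \<le> n"
        then have "b \<le> a" unfolding a b using anti[of n m] True by (intro mult_right_mono) auto
        then show False using ab by simp
      qed
      then show ?thesis using True q a b qc[of m "n - m"] by auto
    next
      case c: False
      have "c < 0" using c False a by (cases "c = 0") auto
      have "n \<le> m"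
      proof (rule ccontr)
        assume "\<not> n \<le> m"
        then have "b \<le> a" unfolding a b using anti[of m n] \<open>c < 0\<close> by (intro mult_right_mono_neg) auto
        then show False using ab by simp
      qed
      moreover have "a < 0" unfolding a using \<open>c < 0\<close> q by (intro mult_pos_neg) auto
      ultimately show ?thesis using a b qc[of n "m - n"] by auto
    qed
  qed auto
  then show ?thesis
  proof (elim disjE conjE exE)
    assume "a = 0"
    then show ?thesis using ab q2 series[of b] by (simp add: qint_def qint0_def)
  next
    assume "b = 0"
    then show ?thesis using ab q2 series[of a]
      by (simp add: qint_def qint0_def mult_nonneg_nonpos mult_nonpos_nonneg)
  next
    fix k assume "0 < b" "a = q ^ (2 * k) * b"
    then show ?thesis using qint0_lattice_step[OF sum[of b], of k] q q2 partial[of b k]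
      by (simp add: qint_def)
  next
    \<comment> \<open>Here \<open>a\<close> is the endpoint farther from 0: its integral enters
      \<open>qint\<close> with a minus sign, which the negative factor \<open>a\<close>
      compensates.\<close>
    fix k assume "a < 0" and b: "b = q ^ (2 * k) * a"
    then have "(1 - q\<^sup>2) * a * (\<Sum>n<k. q ^ (2 * n) * f (q ^ (2 * n + 1) * a)) \<le> 0"
      using q2 partial[of a k] by (intro mult_nonpos_nonneg mult_nonneg_nonpos) simp_all
    then show ?thesis using qint0_lattice_step[OF sum[of a], of k] q b
      by (simp add: qint_def)
  qed
qed

lemma qint_lattice_mono:
  assumes "0 < q" "q < 1" "a < b" "a \<in> qpts q c" "b \<in> qpts q c"
    and "\<And>x. x \<in> {a, b} \<Longrightarrow> qsummable q x f" "\<And>x. x \<in> {a, b} \<Longrightarrow> qsummable q x g"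
    and "\<And>t. t \<in> qpts2 q a b \<Longrightarrow> f t \<le> g t"
  shows "qint q a b f \<le> qint q a b g"
  using qint_lattice_nonneg[of q a b c "\<lambda>t. g t - f t"] qint_diff[of a b q g f] assms
  by (simp add: qsummable_diff)

section \<open>Continuity at 0 and convergence of the series\<close>

lemma interval_scale_mem:
  fixes I :: "real set"
  assumes "is_interval I" "0 \<in> I" "x \<in> I" "0 \<le> r" "r \<le> 1"
  shows "r * x \<in> I"
  using convexD_alt[of I 0 x r] assms is_interval_convex by fastforce

text \<open>The exponent \<open>e\<close> is left free because two sequences occur: odd powers for
  the nodes of the integral, even powers for the ends of the telescoping differences.\<close>

lemma tendsto_along_powers:
  fixes f :: "real \<Rightarrow> real"
  assumes "0 < q" "q < 1" "is_interval I" "0 \<in> I" "x \<in> I"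
    and "continuous (at 0 within I) f"
    and "strict_mono e"
  shows "(\<lambda>n. f (q ^ e n * x)) \<longlonglongrightarrow> f 0"
proof (rule continuous_within_tendsto_compose'[OF assms(6)])
  show "q ^ e n * x \<in> I" for n
    using assms by (intro interval_scale_mem) (auto intro: power_le_one)
  have "(\<lambda>n. q ^ n) \<longlonglongrightarrow> 0" using assms by (intro LIMSEQ_realpow_zero) auto
  then have "(\<lambda>n. q ^ e n) \<longlonglongrightarrow> 0"
    using LIMSEQ_subseq_LIMSEQ[of "\<lambda>n. q ^ n" 0 e] assms by (simp add: comp_def)
  then show "(\<lambda>n. q ^ e n * x) \<longlonglongrightarrow> 0" by (rule tendsto_mult_left_zero)
qed

text \<open>The values at the nodes converge to \<open>f 0\<close>, hence are bounded, and a
  geometric series of ratio \<open>q\<^sup>2\<close> dominates.\<close>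

lemma qsummable_continuous:
  assumes "0 < q" "q < 1" "is_interval I" "0 \<in> I" "x \<in> I"
    and "continuous (at 0 within I) f"
  shows "qsummable q x f"
proof -
  have "(\<lambda>n. f (q ^ (2 * n + 1) * x)) \<longlonglongrightarrow> f 0"
    using assms by (intro tendsto_along_powers) (auto simp: strict_mono_def)
  then obtain K where K: "\<And>n. norm (f (q ^ (2 * n + 1) * x)) \<le> K"
    using BseqE[OF convergent_imp_Bseq[OF convergentI]] by metis
  have "summable (\<lambda>n. K * (q\<^sup>2) ^ n)"
    using assms by (intro summable_mult summable_geometric) (simp add: power_less_one_iff)
  then show ?thesis unfolding qsummable_def
  proof (rule summable_comparison_test'[where N = 0])
    fix n
    show "norm (q ^ (2 * n) * f (q ^ (2 * n + 1) * x)) \<le> K * (q\<^sup>2) ^ n"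
      using mult_left_mono[OF K[of n], of "q ^ (2 * n)"] assms
      by (simp add: abs_mult power_mult[symmetric] mult.commute)
  qed
qed

section \<open>Calculus of the symmetric derivative away from 0\<close>

lemma qsymD_diff:
  assumes "t \<noteq> 0"
  shows "qsymD q I (\<lambda>s. f s - g s) t = qsymD q I f t - qsymD q I g t"
  using assms by (simp add: qsymD_def diff_divide_distrib[symmetric])

text \<open>Of the two forms of the product rule, this one evaluates the first factor at
  \<open>inverse q * t\<close>. A first factor \<open>g (q * s)\<close> then contributes exactly
  \<open>g t\<close>.\<close>

lemma qsymD_mult:
  assumes "t \<noteq> 0"
  shows "qsymD q I (\<lambda>s. f s * h s) t
    = qsymD q I f t * h (q * t) + f (inverse q * t) * qsymD q I h t"
proof -
  have "(f (q * t) * h (q * t) - f (inverse q * t) * h (inverse q * t))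
      = (f (q * t) - f (inverse q * t)) * h (q * t) + f (inverse q * t) * (h (q * t) - h (inverse q * t))"
    by (simp add: algebra_simps)
  then show ?thesis using assms by (simp add: qsymD_def add_divide_distrib)
qed

text \<open>The node \<open>q ^ (2 * n + 1) * x\<close> is scaled by \<open>inverse q\<close> and
  \<open>q\<close> to two consecutive even-power points, and the weight cancels the denominator of
  the quotient, so the terms telescope.\<close>

lemma qsymD_sums:
  assumes q: "0 < q" "q < 1" and "x \<noteq> 0"
    and lim: "(\<lambda>n. G (q ^ (2 * n) * x)) \<longlonglongrightarrow> l"
  shows "(\<lambda>n. (1 - q\<^sup>2) * x * (q ^ (2 * n) * qsymD q I G (q ^ (2 * n + 1) * x))) sums (G x - l)"
proof -
  have "(1 - q\<^sup>2) * x * (q ^ (2 * n) * qsymD q I G (q ^ (2 * n + 1) * x))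
      = G (q ^ (2 * n) * x) - G (q ^ (2 * Suc n) * x)" for n
  proof -
    have "q\<^sup>2 \<noteq> 1" using q by (simp add: power_less_one_iff less_imp_neq)
    \<comment> \<open>The denominator is minus the weight, so each term is the value at the outer
      point minus the value at the inner one.\<close>
    then have "(q - inverse q) * (q ^ (2 * n + 1) * x) = - ((1 - q\<^sup>2) * x * q ^ (2 * n))"
      using q by (simp add: field_simps power2_eq_square)
    moreover have "(1 - q\<^sup>2) * x * q ^ (2 * n) \<noteq> 0" using q \<open>x \<noteq> 0\<close> \<open>q\<^sup>2 \<noteq> 1\<close> by simp
    moreover have "q * (q ^ (2 * n + 1) * x) = q ^ (2 * Suc n) * x"
      "inverse q * (q ^ (2 * n + 1) * x) = q ^ (2 * n) * x"
      using q by simp_all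
    moreover have "q ^ (2 * n + 1) * x \<noteq> 0" using q \<open>x \<noteq> 0\<close> by simp
    moreover have "d * (p * ((u - v) / - (d * p))) = v - u" if "d * p \<noteq> 0" for d p u v :: real
      using that by (simp add: divide_simps)
    ultimately show ?thesis
      by (simp only: qsymD_def if_False mult.assoc[of "(1 - q\<^sup>2) * x"])
  qed
  then show ?thesis using telescope_sums'[OF lim] by simp
qed

text \<open>This is the fundamental theorem of calculus on the lattice, with the limit
  \<open>l\<close> along even powers as the value at 0. The nonzero prefactor can be divided out to
  get summability.\<close>

lemma qint0_qsymD:
  assumes q: "0 < q" "q < 1" and "x \<noteq> 0"
    and lim: "(\<lambda>n. G (q ^ (2 * n) * x)) \<longlonglongrightarrow> l"
  shows "qsummable q x (qsymD q I G)" and "qint0 q x (qsymD q I G) = G x - l"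
proof -
  have nz: "(1 - q\<^sup>2) * x \<noteq> 0"
    using q \<open>x \<noteq> 0\<close> by (simp add: power_less_one_iff less_imp_neq[symmetric])
  show summ: "qsummable q x (qsymD q I G)"
    unfolding qsummable_def
    using sums_summable[OF qsymD_sums[OF assms, of I]] nz summable_cmult_iff by blast
  show "qint0 q x (qsymD q I G) = G x - l"
    using sums_unique[OF qsymD_sums[OF assms, of I]]
      suminf_mult[OF summ[unfolded qsummable_def], of "(1 - q\<^sup>2) * x"]
    by (simp add: qint0_def)
qed

section \<open>Sufficiency of the Euler-Lagrange equation\<close>

theorem theorem6p3p7:
  fixes q a b c \<alpha> \<beta> :: real
    and I :: "real set"
    and L :: "real \<Rightarrow> real \<Rightarrow> real \<Rightarrow> real"
    and ystar :: "real \<Rightarrow> real"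
  assumes q: "0 < q" "q < 1"
    and I: "is_interval I" "0 \<in> I"
    and ab: "a \<in> I" "b \<in> I" "a < b"
    and c: "c \<in> I" "a \<in> qpts q c" "b \<in> qpts q c"
    and L_C1: "\<And>t. t \<in> {a..b} \<Longrightarrow> C1_plane (\<lambda>(u, v). L t u v)"
    and L_cont: "\<And>y. admissible q I a b \<alpha> \<beta> y \<Longrightarrow>
      continuous (at 0 within I) (\<lambda>t. L t (y (q * t)) (qsymD q I y t))"
    and L_partial2: "\<And>y. admissible q I a b \<alpha> \<beta> y \<Longrightarrow>
      (\<lambda>t. partial2 L t (y (q * t)) (qsymD q I y t)) \<in> qY1 q I a b"
    and L_partial3: "\<And>y. admissible q I a b \<alpha> \<beta> y \<Longrightarrow>
      (\<lambda>t. partial3 L t (y (q * t)) (qsymD q I y t)) \<in> qY1 q I a b"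
    and ystar: "admissible q I a b \<alpha> \<beta> ystar"
    and euler_lagrange: "\<And>t. t \<in> qpts2 q a b \<Longrightarrow>
      partial2 L t (ystar (q * t)) (qsymD q I ystar t) =
      qsymD q I (\<lambda>\<tau>. partial3 L (q * \<tau>) (ystar (q\<^sup>2 * \<tau>)) (qsymD q I ystar (q * \<tau>))) t"
  shows "(jointly_convex I L \<longrightarrow> global_minimizer q I a b \<alpha> \<beta> L ystar) \<and>
         (jointly_concave I L \<longrightarrow> global_maximizer q I a b \<alpha> \<beta> L ystar)"
proof -
  define F where "F = (\<lambda>y t. L t (y (q * t)) (qsymD q I y t))"
  define P where "P = (\<lambda>t. partial2 L t (ystar (q * t)) (qsymD q I ystar t))"
  define g where "g = (\<lambda>t. partial3 L t (ystar (q * t)) (qsymD q I ystar t))"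
  \<comment> \<open>The first-order part of \<open>F y - F ystar\<close> at \<open>ystar\<close>; it
    bounds this difference from below in the convex case and from above in the concave one.\<close>
  define A where "A = (\<lambda>y t. P t * (y (q * t) - ystar (q * t)) + g t * (qsymD q I y t - qsymD q I ystar t))"
  have pts_I: "t \<in> I" if t: "t \<in> qpts2 q a b" for t
  proof -
    have "q ^ (2 * n + 1) * x \<in> I" if "x \<in> {a, b}" for n x
      using that q ab I by (intro interval_scale_mem power_le_one) auto
    then show ?thesis using t I by (auto simp: qpts2_def qpts_def)
  qed
  \<comment> \<open>The right-hand side is the same for both endpoints: \<open>y - ystar\<close>
    vanishes there, so only the limit at 0 survives, and it cancels in \<open>qint\<close>.\<close>
  have A_x: "qsummable q x (A y) \<and> qint0 q x (A y) = - (g 0 * (y 0 - ystar 0))"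
    if x: "x \<in> {a, b}" and y: "admissible q I a b \<alpha> \<beta> y" for x y
  proof -
    define h where "h = (\<lambda>t. y t - ystar t)"
    define G where "G = (\<lambda>t. g (q * t) * h t)"
    have xI: "x \<in> I" using x ab by auto
    have h_x: "h x = 0" using x y ystar by (auto simp: admissible_def h_def)
    have cont_h: "continuous (at 0 within I) h" and cont_g: "continuous (at 0 within I) g"
      using y ystar L_partial3[OF ystar]
      by (auto simp: admissible_def qY1_def h_def g_def intro!: continuous_diff)
    show ?thesis
    \<comment> \<open>If 0 is itself an endpoint, there is nothing to telescope: the prefactor makes
      the integral 0, and the boundary condition gives \<open>h 0 = 0\<close>.\<close>
    proof (cases "x = 0")
      case True
      have "summable (\<lambda>n. (q\<^sup>2) ^ n * A y 0)"
        using q by (intro summable_mult2 summable_geometric) (simp add: power_less_one_iff)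
      then have "qsummable q x (A y)" using True by (simp add: qsummable_def power_mult)
      then show ?thesis using True h_x by (simp add: qint0_def h_def)
    next
      case False
      \<comment> \<open>The shift by \<open>q\<close> inside \<open>G\<close> turns the even powers
        of the telescoping points into odd ones for \<open>g\<close>, while \<open>h\<close> keeps
        the even ones.\<close>
      have "(\<lambda>n. g (q ^ (2 * n + 1) * x)) \<longlonglongrightarrow> g 0"
        by (rule tendsto_along_powers[OF q I xI cont_g]) (simp add: strict_mono_def)
      moreover have "(\<lambda>n. h (q ^ (2 * n) * x)) \<longlonglongrightarrow> h 0"
        by (rule tendsto_along_powers[OF q I xI cont_h]) (simp add: strict_mono_def)
      ultimately have lim: "(\<lambda>n. G (q ^ (2 * n) * x)) \<longlonglongrightarrow> g 0 * h 0"
        unfolding G_def by (auto intro: tendsto_mult simp: mult.assoc)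
      have "A y (q ^ (2 * n + 1) * x) = qsymD q I G (q ^ (2 * n + 1) * x)" for n
      proof -
        let ?t = "q ^ (2 * n + 1) * x"
        have t: "?t \<in> qpts2 q a b" using x unfolding qpts2_def qpts_def by blast
        have nz: "?t \<noteq> 0" using q False by simp
        \<comment> \<open>The function differentiated in the Euler-Lagrange equation is
          \<open>g\<close> composed with multiplication by \<open>q\<close>, so \<open>P\<close>
          supplies the first term of the product rule.\<close>
        have "P ?t = qsymD q I (\<lambda>s. g (q * s)) ?t"
          using euler_lagrange[OF t] by (simp add: P_def g_def power2_eq_square mult.assoc)
        moreover have "g (q * (inverse q * ?t)) = g ?t"
          using q by (simp add: mult.assoc[symmetric])
        ultimately show ?thesis
          using qsymD_mult[OF nz, of q I "\<lambda>s. g (q * s)" h] qsymD_diff[OF nz, of q I y ystar]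
          unfolding A_def G_def h_def by simp
      qed
      then show ?thesis
        using qint0_qsymD[OF q False lim, of I] h_x
        by (simp add: qsummable_def qint0_def G_def h_def)
    qed
  qed
  have qint_A: "qint q a b (A y) = 0" if "admissible q I a b \<alpha> \<beta> y" for y
    using A_x that by (simp add: qint_def)
  have summ: "qsummable q x (F y)" if "x \<in> {a, b}" "admissible q I a b \<alpha> \<beta> y" for x y
    using that ab L_cont qsummable_continuous[OF q I] by (auto simp: F_def)
  have functional: "qfunctional q I a b L y - qfunctional q I a b L ystar
      = qint q a b (\<lambda>t. F y t - F ystar t)" if "admissible q I a b \<alpha> \<beta> y" for y
    using qint_diff[of a b q "F y" "F ystar"] summ that ystar
    by (simp add: qfunctional_def F_def)
  have D_summ: "qsummable q x (\<lambda>t. F y t - F ystar t)"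
    if "x \<in> {a, b}" "admissible q I a b \<alpha> \<beta> y" for x y
    using that ystar by (intro qsummable_diff summ)
  show ?thesis
  proof (intro conjI impI)
    assume conv: "jointly_convex I L"
    have "A y t \<le> F y t - F ystar t" if "t \<in> qpts2 q a b" for y t
    proof -
      have "\<forall>u v u1 v1. partial2 L t u v * u1 + partial3 L t u v * v1
          \<le> L t (u + u1) (v + v1) - L t u v"
        using conv pts_I[OF that] by (simp add: jointly_convex_def)
      from this[rule_format, of "ystar (q * t)" "qsymD q I ystar t"
          "y (q * t) - ystar (q * t)" "qsymD q I y t - qsymD q I ystar t"]
      show ?thesis by (simp add: F_def A_def P_def g_def)
    qed
    then have "0 \<le> qfunctional q I a b L y - qfunctional q I a b L ystar"
      if "admissible q I a b \<alpha> \<beta> y" for y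
      using qint_lattice_mono[OF q ab(3) c(2,3), of "A y" "\<lambda>t. F y t - F ystar t"]
        A_x D_summ qint_A functional that by simp
    then show "global_minimizer q I a b \<alpha> \<beta> L ystar"
      using ystar by (simp add: global_minimizer_def)
  next
    assume conc: "jointly_concave I L"
    have "F y t - F ystar t \<le> A y t" if "t \<in> qpts2 q a b" for y t
    proof -
      have "\<forall>u v u1 v1. L t (u + u1) (v + v1) - L t u v
          \<le> partial2 L t u v * u1 + partial3 L t u v * v1"
        using conc pts_I[OF that] by (simp add: jointly_concave_def)
      \<comment> \<open>The variables are filled in order of occurrence, here \<open>u\<close>,
        \<open>u1\<close>, \<open>v\<close>, \<open>v1\<close>, so base point and increment
        alternate.\<close>
      from this[rule_format, of "ystar (q * t)" "y (q * t) - ystar (q * t)"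
          "qsymD q I ystar t" "qsymD q I y t - qsymD q I ystar t"]
      show ?thesis by (simp add: F_def A_def P_def g_def)
    qed
    then have "qfunctional q I a b L y - qfunctional q I a b L ystar \<le> 0"
      if "admissible q I a b \<alpha> \<beta> y" for y
      using qint_lattice_mono[OF q ab(3) c(2,3), of "\<lambda>t. F y t - F ystar t" "A y"]
        A_x D_summ qint_A functional that by simp
    then show "global_maximizer q I a b \<alpha> \<beta> L ystar"
      using ystar by (simp add: global_maximizer_def)
  qed
qed

end
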